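(* Let $C:=[l,u]\subset\mathbb R^n$ be a nonempty box and $g=\delta_C$ its indicator function. Suppose that either $f(x)=c^\top x$, or $f(x)=\frac12x^\top Hx+c^\top x$ with $H\succeq0$. Then for every $w^\star\in W^\star$ there exist a neighborhood $U$ of $w^\star$ and a constant $\alpha_U>0$ such that $$\alpha_U\operatorname{dist}(w,W^\star)\le\operatorname{dist}(0,\mathcal T(w))\qquad\forall w\in U .$$ Consequently, if $\mathcal M\succ0$ and $\mathcal K\subset\mathbb R^n\times\mathbb R^m$ satisfies $\widehat{\mathcal T}(\mathcal K)\cup\widehat{\mathcal T}_{\rm lin}(\mathcal K)\subset U$, then both $F=\widehat{\mathcal T}$ and $F=\widehat{\mathcal T}_{\rm lin}$ satisfy the sharpness condition on $\mathcal K$: there is $\alpha>0$ with $$\alpha\operatorname{dist}_{\mathcal M}(w,W^\star)\le\|w-F(w)\|_{\mathcal M}\qquad\forall w\in\mathcal K .$$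
   Context: Setting: $A\in\mathbb R^{m\times n}$, $b\in\mathbb R^m$, $\sigma\ge0$, $c\in\mathbb R^n$, $H\in\mathbb R^{n\times n}$ symmetric; $P\in\mathbb R^{n\times n}$, $Q\in\mathbb R^{m\times m}$ are self-adjoint positive semidefinite. Define $$\mathcal M=\begin{pmatrix} P & A^\top \\ A & Q \end{pmatrix},\qquad \mathcal T(x,y)=\begin{pmatrix} \nabla f(x)+\partial g(x)-A^\top y+\sigma A^\top(Ax-b) \\ Ax-b \end{pmatrix},\qquad W^\star:=\mathcal T^{-1}(0),$$ where $W^\star$ is assumed nonempty. The function $h:\mathbb R^n\to\mathbb R$ is convex and continuously differentiable with $L_h$-Lipschitz gradient and such that $f-h+\frac\sigma2\|A\cdot-b\|^2$ is convex; $\mathcal B_h(x,y)=(\nabla h(x),0)$ and $\mathcal A_h:=\mathcal T-\mathcal B_h$. The exact map is $\widehat{\mathcal T}:=(\mathcal M+\mathcal T)^{-1}\mathcal M$ and the linearized map is $\widehat{\mathcal T}_{\rm lin}(w):=(\mathcal M+\mathcal A_h)^{-1}(\mathcal Mw-\mathcal B_h(w))$; when $\mathcal M\succ0$ both are single-valued and everywhere defined. Notation: $\|w\|_{\mathcal M}=\sqrt{\langle w,\mathcal Mw\rangle}$, $\operatorname{dist}_{\mathcal M}(w,S)=\inf_{u\in S}\|w-u\|_{\mathcal M}$; $\operatorname{dist}$ is Euclidean distance. *)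

theory Defs
  imports "HOL-Analysis.Analysis"
begin

text \<open>Convex analysis\<close>

definition gradient :: "('a::real_inner \<Rightarrow> real) \<Rightarrow> 'a \<Rightarrow> 'a" where
  "gradient f x = (THE D. GDERIV f x :> D)"

lemma gradient_eqI:
  assumes "GDERIV f x :> D"
  shows "gradient f x = D"
  unfolding gradient_def
proof (rule the_equality)
  show "GDERIV f x :> D" by fact
next
  fix E
  assume "GDERIV f x :> E"
  with assms have "(\<lambda>k. inner k E) = (\<lambda>k. inner k D)"
    unfolding gderiv_def by (rule has_derivative_unique[rotated])
  then have "inner (E - D) E = inner (E - D) D"
    by metis
  then have "inner (E - D) (E - D) = 0"
    by (simp add: inner_diff_right)
  then show "E = D" by simp
qed

definition indicator_fun :: "'a set \<Rightarrow> 'a \<Rightarrow> ereal" where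
  "indicator_fun C x = (if x \<in> C then 0 else \<infinity>)"

definition subdifferential :: "('a::real_inner \<Rightarrow> ereal) \<Rightarrow> 'a \<Rightarrow> 'a set" where
  "subdifferential g x = {v. \<bar>g x\<bar> \<noteq> \<infinity> \<and> (\<forall>z. g x + ereal (inner v (z - x)) \<le> g z)}"

text \<open>The bounds of a box may be infinite; real bounds give \<^const>\<open>cbox\<close>, see below.\<close>

definition ext_box :: "ereal^'n \<Rightarrow> ereal^'n \<Rightarrow> (real^'n) set" where
  "ext_box l u = {x. \<forall>i. l $ i \<le> ereal (x $ i) \<and> ereal (x $ i) \<le> u $ i}"

lemma ext_box_real: "ext_box (\<chi> i. ereal (l $ i)) (\<chi> i. ereal (u $ i)) = cbox l u"
  by (auto simp: ext_box_def mem_box_cart)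

text \<open>
  Distance to a possibly empty set, with value \<open>\<infinity>\<close> on the empty set. This matters for
  \<open>dist(0, T w)\<close>, since \<open>T w\<close> is empty for infeasible \<open>w\<close>, whereas \<^const>\<open>infdist\<close> is \<open>0\<close>
  on the empty set.
\<close>

definition ext_dist :: "'a::metric_space \<Rightarrow> 'a set \<Rightarrow> ereal" where
  "ext_dist x S = (INF y\<in>S. ereal (dist x y))"

text \<open>Matrices and self-adjoint operators\<close>

definition psd_matrix :: "real^'n^'n \<Rightarrow> bool" where
  "psd_matrix P \<longleftrightarrow> transpose P = P \<and> (\<forall>x. 0 \<le> inner x (P *v x))"

definition pos_def_op :: "('a::real_inner \<Rightarrow> 'a) \<Rightarrow> bool" where
  "pos_def_op M \<longleftrightarrow>
     linear M \<and> (\<forall>v w. inner v (M w) = inner (M v) w) \<and> (\<forall>w. w \<noteq> 0 \<longrightarrow> 0 < inner w (M w))"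

definition norm_op :: "('a::real_inner \<Rightarrow> 'a) \<Rightarrow> 'a \<Rightarrow> real" where
  "norm_op M w = sqrt (inner w (M w))"

text \<open>A real infimum, meaningful only for nonempty \<open>S\<close>.\<close>

definition dist_op :: "('a::real_inner \<Rightarrow> 'a) \<Rightarrow> 'a \<Rightarrow> 'a set \<Rightarrow> real" where
  "dist_op M w S = (INF u\<in>S. norm_op M (w - u))"

definition block_op ::
  "real^'n^'n \<Rightarrow> real^'n^'m \<Rightarrow> real^'m^'m \<Rightarrow> (real^'n) \<times> (real^'m) \<Rightarrow> (real^'n) \<times> (real^'m)" where
  "block_op P A Q = (\<lambda>(x, y). (P *v x + transpose A *v y, A *v x + Q *v y))"

text \<open>The KKT operator, its splitting and the two iteration maps\<close>

definition kkt_op ::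
  "real^'n^'m \<Rightarrow> real^'m \<Rightarrow> real \<Rightarrow> (real^'n \<Rightarrow> real) \<Rightarrow> (real^'n \<Rightarrow> ereal)
     \<Rightarrow> (real^'n) \<times> (real^'m) \<Rightarrow> ((real^'n) \<times> (real^'m)) set" where
  "kkt_op A b \<sigma> f g = (\<lambda>(x, y).
     {(gradient f x + v - transpose A *v y + \<sigma> *\<^sub>R (transpose A *v (A *v x - b)), A *v x - b) | v.
        v \<in> subdifferential g x})"

definition zeros :: "('a \<Rightarrow> 'b::zero set) \<Rightarrow> 'a set" where
  "zeros T = {w. 0 \<in> T w}"

definition lin_op :: "('a::real_inner \<Rightarrow> real) \<Rightarrow> 'a \<times> 'b::real_inner \<Rightarrow> 'a \<times> 'b" where
  "lin_op h = (\<lambda>(x, y). (gradient h x, 0))"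

text \<open>The set \<open>(M + S)\<inverse>(r)\<close> for a single-valued \<open>M\<close> and a set-valued \<open>S\<close>.\<close>

definition inv_sum :: "('a \<Rightarrow> 'b::plus) \<Rightarrow> ('a \<Rightarrow> 'b set) \<Rightarrow> 'b \<Rightarrow> 'a set" where
  "inv_sum M S r = {z. \<exists>v\<in>S z. r = M z + v}"

text \<open>
  Both maps are set-valued in general. The definitions below pick the element of a singleton value;
  they are meaningful when the values are singletons, as is the case for positive definite \<open>M\<close>.
\<close>

definition exact_map :: "('a \<Rightarrow> 'a::real_inner) \<Rightarrow> ('a \<Rightarrow> 'a set) \<Rightarrow> 'a \<Rightarrow> 'a" where
  "exact_map M T w = the_elem (inv_sum M T (M w))"

definition linearized_map ::
  "('a \<Rightarrow> 'a::real_inner) \<Rightarrow> ('a \<Rightarrow> 'a set) \<Rightarrow> ('a \<Rightarrow> 'a) \<Rightarrow> 'a \<Rightarrow> 'a" where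
  "linearized_map M T B w = the_elem (inv_sum M (\<lambda>z. (\<lambda>v. v - B z) ` T z) (M w - B w))"

definition error_bound_on ::
  "('a::real_normed_vector \<Rightarrow> 'a set) \<Rightarrow> 'a set \<Rightarrow> real \<Rightarrow> bool" where
  "error_bound_on T U \<alpha> \<longleftrightarrow> (\<forall>w\<in>U. ereal (\<alpha> * infdist w (zeros T)) \<le> ext_dist 0 (T w))"

definition sharp_on ::
  "('a::real_inner \<Rightarrow> 'a) \<Rightarrow> 'a set \<Rightarrow> ('a \<Rightarrow> 'a) \<Rightarrow> 'a set \<Rightarrow> bool" where
  "sharp_on M W F K \<longleftrightarrow> (\<exists>\<alpha>>0. \<forall>w\<in>K. \<alpha> * dist_op M w W \<le> norm_op M (w - F w))"

end

theory Submission
  imports Defs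
begin

text \<open>
  For an affine gradient and a box, \<open>T\<close> is polyhedral: prescribing the signs of the normal vector \<open>v\<close>
  cuts its graph into finitely many polyhedra. On a piece, an element \<open>r \<in> T w\<close> is a bound for the
  violation at \<open>w\<close> of the linear inequalities that describe the zeros of \<open>T\<close> in this piece. If the
  reference zero satisfies these inequalities, Hoffman's bound applies; if not, the violation is bounded
  away from \<open>0\<close> near the reference zero. Hoffman's bound comes from compactness of the set of unit vectors
  in the polar of the cone of active constraints, on which the violation is positive.

  For the two maps, \<open>M (w - F w)\<close>, corrected by \<open>B (F w) - B w\<close> in the linearized case, lies in \<open>T (F w)\<close>,
  so the error bound at \<open>F w\<close> and the triangle inequality give sharpness.
\<close>

section \<open>Hoffman's error bound\<close>

text \<open>The premise says that \<open>d\<close> lies in the polar of the cone of all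
  \<open>k\<close> with \<open>a i \<bullet> k \<le> 0\<close>. If all positive parts vanish, then
  \<open>d\<close> is in that cone too, so \<open>d \<bullet> d \<le> 0\<close> and
  \<open>d = 0\<close>. Hence the sum is positive on unit vectors of the polar, attains a positive
  minimum there, and extends by homogeneity. Working with the polar itself avoids Farkas'
  lemma.\<close>

lemma polar_cone_bound:
  fixes a :: "'i \<Rightarrow> 'a::euclidean_space"
  assumes "finite I"
  shows "\<exists>m>0. \<forall>d. (\<forall>k. (\<forall>i\<in>I. a i \<bullet> k \<le> 0) \<longrightarrow> d \<bullet> k \<le> 0) \<longrightarrow>
           m * norm d \<le> (\<Sum>i\<in>I. max 0 (a i \<bullet> d))"
proof -
  define N where "N = {d. \<forall>k. (\<forall>i\<in>I. a i \<bullet> k \<le> 0) \<longrightarrow> d \<bullet> k \<le> 0}"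
  define \<phi> where "\<phi> = (\<lambda>d. \<Sum>i\<in>I. max 0 (a i \<bullet> d))"
  have "closed N"
    unfolding N_def by (intro closed_Collect_all closed_Collect_imp closed_Collect_le
        open_Collect_const continuous_intros)
  then have cpt: "compact (sphere 0 1 \<inter> N)"
    by (intro compact_Int_closed) auto
  have cont: "continuous_on (sphere 0 1 \<inter> N) \<phi>"
    unfolding \<phi>_def by (intro continuous_intros)
  have pos: "\<phi> d > 0" if "d \<in> sphere 0 1 \<inter> N" for d
  proof (rule ccontr)
    assume "\<not> \<phi> d > 0"
    then have "\<phi> d = 0"
      unfolding \<phi>_def by (meson linorder_not_le max.cobounded1 order_antisym_conv sum_nonneg)
    then have "\<forall>i\<in>I. max 0 (a i \<bullet> d) = 0"
      unfolding \<phi>_def using assms by (subst (asm) sum_nonneg_eq_0_iff) auto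
    then have "\<forall>i\<in>I. a i \<bullet> d \<le> 0" by (metis max.cobounded2)
    with that have "d \<bullet> d \<le> 0" by (auto simp: N_def)
    then have "d = 0" by (metis inner_ge_zero inner_eq_zero_iff order_antisym)
    then show False using that by auto
  qed
  obtain m where m: "m > 0" "\<And>d. d \<in> sphere 0 1 \<inter> N \<Longrightarrow> m \<le> \<phi> d"
  proof (cases "sphere 0 1 \<inter> N = {}")
    \<comment> \<open>Without unit vectors the polar is trivial and any positive constant
      works.\<close>
    case True
    then show ?thesis using that[of 1] by auto
  next
    case False
    then obtain d0 where "d0 \<in> sphere 0 1 \<inter> N" "\<forall>d\<in>sphere 0 1 \<inter> N. \<phi> d0 \<le> \<phi> d"
      using continuous_attains_inf[OF cpt _ cont] by blast
    then show ?thesis using that[of "\<phi> d0"] pos by auto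
  qed
  have "m * norm d \<le> \<phi> d" if d: "d \<in> N" for d
  proof (cases "d = 0")
    case True
    then show ?thesis by (simp add: \<phi>_def)
  next
    case False
    define s where "s = inverse (norm d)"
    have s: "s > 0" using False by (simp add: s_def)
    have "s *\<^sub>R d \<in> sphere 0 1 \<inter> N"
      using d s False by (auto simp: N_def s_def mult_le_0_iff)
    then have "m \<le> \<phi> (s *\<^sub>R d)" by (rule m)
    also have "\<dots> = s * \<phi> d"
      using s by (auto simp: \<phi>_def sum_distrib_left max_def mult_le_0_iff zero_le_mult_iff intro!: sum.cong)
    finally show ?thesis using False by (simp add: s_def field_simps)
  qed
  then show ?thesis using m(1) by (auto simp: N_def \<phi>_def)
qed

text \<open>If \<open>p\<close> is the projection of \<open>z\<close> onto \<open>X\<close>, then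
  \<open>z - p\<close> is in the polar of the cone given by the constraints active at
  \<open>p\<close>. There \<open>a i \<bullet> p = b i\<close>, so each positive part of
  \<open>a i \<bullet> (z - p)\<close> is at most \<open>r\<close>, and the preceding bound controls
  \<open>norm (z - p)\<close>.\<close>

lemma hoffman_bound:
  fixes a :: "'i \<Rightarrow> 'a::euclidean_space"
  assumes fin: "finite I" and X: "X = {z. \<forall>i\<in>I. a i \<bullet> z \<le> b i}" and ne: "X \<noteq> {}"
  shows "\<exists>\<kappa>>0. \<forall>z r. 0 \<le> r \<longrightarrow> (\<forall>i\<in>I. a i \<bullet> z \<le> b i + r) \<longrightarrow> infdist z X \<le> \<kappa> * r"
proof -
  \<comment> \<open>The active set depends on \<open>z\<close>, so constants are fixed for all
    subsets beforehand; their minimum serves every \<open>z\<close>.\<close>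
  have "\<forall>J\<in>Pow I. \<exists>m>0. \<forall>d. (\<forall>k. (\<forall>i\<in>J. a i \<bullet> k \<le> 0) \<longrightarrow> d \<bullet> k \<le> 0) \<longrightarrow>
           m * norm d \<le> (\<Sum>i\<in>J. max 0 (a i \<bullet> d))"
    using fin by (auto intro!: polar_cone_bound intro: finite_subset)
  then obtain m where m: "\<And>J. J \<subseteq> I \<Longrightarrow> m J > 0"
    "\<And>J d. J \<subseteq> I \<Longrightarrow> (\<And>k. (\<forall>i\<in>J. a i \<bullet> k \<le> 0) \<Longrightarrow> d \<bullet> k \<le> 0) \<Longrightarrow>
           m J * norm d \<le> (\<Sum>i\<in>J. max 0 (a i \<bullet> d))"
    unfolding bchoice_iff by (metis PowI)
  define \<mu> where "\<mu> = Min (m ` Pow I)"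
  have \<mu>: "\<mu> > 0" unfolding \<mu>_def using fin m(1) by (subst Min_gr_iff) auto
  have "X = (\<Inter>i\<in>I. {z. a i \<bullet> z \<le> b i})" by (auto simp: X)
  then have clX: "closed X" and cvX: "convex X"
    by (auto intro!: closed_INT convex_INT closed_halfspace_le convex_halfspace_le)
  \<comment> \<open>The summand 1 keeps the constant positive for empty \<open>I\<close>.\<close>
  have "infdist z X \<le> (real (card I) + 1) / \<mu> * r"
    if r: "0 \<le> r" and viol: "\<forall>i\<in>I. a i \<bullet> z \<le> b i + r" for z r
  proof -
    define p where "p = closest_point X z"
    define J where "J = {i\<in>I. a i \<bullet> p = b i}"
    have pX: "p \<in> X" unfolding p_def by (rule closest_point_in_set[OF clX ne])
    have JI: "J \<subseteq> I" by (auto simp: J_def)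
    have polar: "(z - p) \<bullet> k \<le> 0" if k: "\<forall>i\<in>J. a i \<bullet> k \<le> 0" for k
    proof -
      \<comment> \<open>A short step from \<open>p\<close> along \<open>k\<close> stays in
        \<open>X\<close>: active constraints do not increase along \<open>k\<close>, inactive ones
        have slack. The obtuse angle property of the projection then gives the sign of
        \<open>(z - p) \<bullet> k\<close>.\<close>
      have "\<forall>i\<in>I. \<forall>\<^sub>F t in at_right 0. a i \<bullet> (p + t *\<^sub>R k) \<le> b i"
      proof
        fix i assume i: "i \<in> I"
        show "\<forall>\<^sub>F t in at_right 0. a i \<bullet> (p + t *\<^sub>R k) \<le> b i"
        proof (cases "i \<in> J")
          case True
          then show ?thesis
            using k by (auto simp: J_def inner_add_right mult_le_0_iff eventually_at_filter)
        next
          case False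
          have "((\<lambda>t. a i \<bullet> (p + t *\<^sub>R k)) \<longlongrightarrow> a i \<bullet> (p + 0 *\<^sub>R k)) (at_right 0)"
            by (intro tendsto_intros)
          moreover have "a i \<bullet> (p + 0 *\<^sub>R k) < b i"
            using False i pX by (auto simp: J_def X)
          ultimately show ?thesis
            by (auto dest!: order_tendstoD(2) elim: eventually_mono)
        qed
      qed
      then have "\<forall>\<^sub>F t in at_right 0. \<forall>i\<in>I. a i \<bullet> (p + t *\<^sub>R k) \<le> b i"
        by (rule eventually_ball_finite[OF fin])
      moreover have "\<forall>\<^sub>F t in at_right (0::real). 0 < t"
        by (simp add: eventually_at_filter)
      ultimately have "\<forall>\<^sub>F t in at_right 0. (\<forall>i\<in>I. a i \<bullet> (p + t *\<^sub>R k) \<le> b i) \<and> 0 < t"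
        by (rule eventually_conj)
      then obtain t where t: "t > 0" "\<forall>i\<in>I. a i \<bullet> (p + t *\<^sub>R k) \<le> b i"
        using eventually_happens'[OF trivial_limit_at_right_real] by blast
      then have "p + t *\<^sub>R k \<in> X" by (simp add: X)
      from closest_point_dot[OF cvX clX this, of z] show ?thesis
        using t(1) by (simp add: p_def mult_le_0_iff)
    qed
    have "\<mu> * norm (z - p) \<le> m J * norm (z - p)"
      using fin JI by (intro mult_right_mono) (auto simp: \<mu>_def)
    also have "\<dots> \<le> (\<Sum>i\<in>J. max 0 (a i \<bullet> (z - p)))"
      by (rule m(2)[OF JI polar])
    also have "\<dots> \<le> (\<Sum>i\<in>J. r)"
      using viol r by (intro sum_mono) (auto simp: J_def inner_diff_right)
    also have "\<dots> \<le> (real (card I) + 1) * r"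
      using r card_mono[OF fin JI] by (simp add: mult_right_mono)
    finally have "norm (z - p) \<le> (real (card I) + 1) / \<mu> * r"
      using \<mu> by (simp add: field_simps)
    moreover have "infdist z X \<le> norm (z - p)"
      using infdist_le[OF pX] by (simp add: dist_norm)
    ultimately show ?thesis by linarith
  qed
  moreover have "(real (card I) + 1) / \<mu> > 0" using \<mu> by (simp add: add_nonneg_pos)
  ultimately show ?thesis by blast
qed

text \<open>\<open>W\<close> may be larger than the polyhedron cut out by \<open>F\<close>, so
  \<open>w\<^sub>0\<close> may lie outside this polyhedron, which may even be empty. In that case
  some \<open>\<phi>\<close> stays above half its value at \<open>w\<^sub>0\<close>, which forces
  \<open>r\<close> away from 0, while the distance to \<open>W\<close> stays bounded because
  \<open>w\<^sub>0\<close> is in \<open>W\<close>.\<close>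

lemma local_polyhedral_error_bound:
  fixes F :: "('a::euclidean_space \<Rightarrow> real) set"
  assumes fin: "finite F" and aff: "\<And>\<phi>. \<phi> \<in> F \<Longrightarrow> linear (\<lambda>w. \<phi> w - \<phi> 0)"
    and sub: "{w. \<forall>\<phi>\<in>F. \<phi> w \<le> 0} \<subseteq> W" and w0: "w\<^sub>0 \<in> W"
  shows "\<exists>\<epsilon>>0. \<exists>\<alpha>>0. \<forall>w\<in>ball w\<^sub>0 \<epsilon>. \<forall>r\<ge>0. (\<forall>\<phi>\<in>F. \<phi> w \<le> r) \<longrightarrow> \<alpha> * infdist w W \<le> r"
proof (cases "\<forall>\<phi>\<in>F. \<phi> w\<^sub>0 \<le> 0")
  case True
  \<comment> \<open>The adjoint of a linear functional, evaluated at 1, is the vector that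
    represents it by the inner product.\<close>
  define a where "a = (\<lambda>\<phi>::'a \<Rightarrow> real. adjoint (\<lambda>w. \<phi> w - \<phi> 0) 1)"
  have a: "\<phi> w = a \<phi> \<bullet> w + \<phi> 0" if "\<phi> \<in> F" for \<phi> w
    using adjoint_works[OF aff[OF that], of w 1] by (simp add: a_def inner_commute)
  define X where "X = {z. \<forall>\<phi>\<in>F. a \<phi> \<bullet> z \<le> - \<phi> 0}"
  have X: "X = {w. \<forall>\<phi>\<in>F. \<phi> w \<le> 0}"
    unfolding X_def using a by (auto simp: algebra_simps) (smt (verit) a)+
  then have ne: "X \<noteq> {}" using True by auto
  obtain \<kappa> where \<kappa>: "\<kappa> > 0"
    "\<And>z r. 0 \<le> r \<Longrightarrow> (\<forall>\<phi>\<in>F. a \<phi> \<bullet> z \<le> - \<phi> 0 + r) \<Longrightarrow> infdist z X \<le> \<kappa> * r"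
    using hoffman_bound[OF fin X_def ne] by blast
  have "1 / \<kappa> * infdist w W \<le> r" if r: "r \<ge> 0" "\<forall>\<phi>\<in>F. \<phi> w \<le> r" for w r
  proof -
    have "infdist w W \<le> infdist w X"
      using ne sub X by (intro infdist_mono) auto
    also have "\<dots> \<le> \<kappa> * r"
      using r a by (intro \<kappa>(2)) (auto, smt (verit) a)
    finally show ?thesis using \<kappa>(1) by (simp add: field_simps)
  qed
  then show ?thesis
    using \<kappa>(1) by (intro exI[of _ 1] conjI exI[of _ "1 / \<kappa>"]) auto
next
  case False
  then obtain \<phi> where \<phi>: "\<phi> \<in> F" "\<phi> w\<^sub>0 > 0" by force
  have "continuous (at w\<^sub>0) (\<lambda>w. (\<phi> w - \<phi> 0) + \<phi> 0)"
    by (intro continuous_intros linear_continuous_at linear_conv_bounded_linear[THEN iffD1] aff \<phi>(1))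
  then have "(\<phi> \<longlongrightarrow> \<phi> w\<^sub>0) (nhds w\<^sub>0)"
    by (simp add: continuous_at tendsto_at_iff_tendsto_nhds)
  then have "\<forall>\<^sub>F w in nhds w\<^sub>0. \<phi> w\<^sub>0 / 2 < \<phi> w"
    using \<phi>(2) by (intro order_tendstoD(1)) auto
  then obtain e where e: "e > 0" "\<And>w. dist w w\<^sub>0 < e \<Longrightarrow> \<phi> w\<^sub>0 / 2 < \<phi> w"
    by (auto simp: eventually_nhds_metric)
  \<comment> \<open>Radius at most 1 gives \<open>infdist w W \<le> 1\<close>, so half the value at
    \<open>w\<^sub>0\<close> can serve as the constant.\<close>
  have "\<phi> w\<^sub>0 / 2 * infdist w W \<le> r"
    if "w \<in> ball w\<^sub>0 (min 1 e)" "\<forall>\<phi>\<in>F. \<phi> w \<le> r" for w r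
  proof -
    have "infdist w W \<le> 1"
      using infdist_le[OF w0, of w] that(1) by (simp add: dist_commute)
    then have "\<phi> w\<^sub>0 / 2 * infdist w W \<le> \<phi> w\<^sub>0 / 2"
      using \<phi>(2) mult_left_mono[of "infdist w W" 1 "\<phi> w\<^sub>0 / 2"] by simp
    also have "\<dots> \<le> \<phi> w" using e(2)[of w] that(1) by (simp add: dist_commute)
    also have "\<dots> \<le> r" using that(2) \<phi>(1) by auto
    finally show ?thesis .
  qed
  then show ?thesis
    using e(1) \<phi>(2) by (intro exI[of _ "min 1 e"] conjI exI[of _ "\<phi> w\<^sub>0 / 2"]) auto
qed

section \<open>Inclusions with the normal cone of a box\<close>

lemma subdifferential_indicator_fun:
  "v \<in> subdifferential (indicator_fun C) x \<longleftrightarrow> x \<in> C \<and> (\<forall>z\<in>C. v \<bullet> (z - x) \<le> 0)"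
  by (auto simp: subdifferential_def indicator_fun_def)

lemma ext_box_eq_INT:
  "ext_box l u = (\<Inter>i. {x. l $ i \<le> ereal (x $ i)} \<inter> {x. ereal (x $ i) \<le> u $ i})"
  by (auto simp: ext_box_def)

lemma convex_ext_box: "convex (ext_box l u)"
proof -
  have ge: "convex {x::real^'n. a \<le> ereal (x $ i)}" for a i
  proof (cases a)
    case (real r)
    have "{x::real^'n. a \<le> ereal (x $ i)} = {x. axis i 1 \<bullet> x \<ge> r}"
      by (simp add: real inner_axis')
    then show ?thesis by (simp only: convex_halfspace_ge)
  qed simp_all
  have le: "convex {x::real^'n. ereal (x $ i) \<le> a}" for a i
  proof (cases a)
    case (real r)
    have "{x::real^'n. ereal (x $ i) \<le> a} = {x. axis i 1 \<bullet> x \<le> r}"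
      by (simp add: real inner_axis')
    then show ?thesis by (simp only: convex_halfspace_le)
  qed simp_all
  show ?thesis unfolding ext_box_eq_INT by (intro convex_INT convex_Int ge le)
qed

lemma closed_ext_box: "closed (ext_box l u)"
  unfolding ext_box_eq_INT
  by (intro closed_INT ballI closed_Int closed_Collect_le continuous_intros continuous_on_ereal)

text \<open>If coordinate \<open>i\<close> were strictly below its bound, raising it slightly would
  stay in the box and make the inner product with \<open>v\<close> positive. The conclusion also
  shows that this bound is finite.\<close>

lemma ext_box_normal_upper:
  fixes l u :: "ereal^'n"
  assumes x: "x \<in> ext_box l u" and v: "\<forall>z\<in>ext_box l u. v \<bullet> (z - x) \<le> 0" and pos: "v $ i > 0"
  shows "ereal (x $ i) = u $ i"
proof (rule ccontr)
  assume "ereal (x $ i) \<noteq> u $ i"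
  then have "ereal (x $ i) < u $ i" using x by (auto simp: ext_box_def less_le)
  then obtain t where t: "x $ i < t" "ereal t < u $ i"
    using ereal_dense2 by (metis less_ereal.simps(1))
  define z where "z = x + (t - x $ i) *\<^sub>R axis i 1"
  have "z \<in> ext_box l u"
    using x t by (auto simp: ext_box_def z_def axis_def intro: order_trans[of _ "ereal (x $ i)"])
  with v have "v \<bullet> (z - x) \<le> 0" by blast
  then have "(t - x $ i) * v $ i \<le> 0" by (simp add: z_def inner_axis)
  with t(1) pos show False by (simp add: mult_le_0_iff)
qed

text \<open>Reflection at the origin turns lower bounds into upper bounds and reverses normal
  vectors.\<close>

lemma ext_box_normal_lower:
  fixes l u :: "ereal^'n"
  assumes x: "x \<in> ext_box l u" and v: "\<forall>z\<in>ext_box l u. v \<bullet> (z - x) \<le> 0" and neg: "v $ i < 0"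
  shows "ereal (x $ i) = l $ i"
proof -
  have mem: "- z \<in> ext_box (\<chi> i. - u $ i) (\<chi> i. - l $ i) \<longleftrightarrow> z \<in> ext_box l u" for z
    by (auto simp: ext_box_def ereal_minus_le_minus simp flip: uminus_ereal.simps)
  have "ereal ((- x) $ i) = (\<chi> i. - l $ i) $ i"
  proof (rule ext_box_normal_upper)
    show "- x \<in> ext_box (\<chi> i. - u $ i) (\<chi> i. - l $ i)" using x by (simp only: mem)
    show "\<forall>z\<in>ext_box (\<chi> i. - u $ i) (\<chi> i. - l $ i). (- v) \<bullet> (z - (- x)) \<le> 0"
    proof
      fix z assume "z \<in> ext_box (\<chi> i. - u $ i) (\<chi> i. - l $ i)"
      then have "- z \<in> ext_box l u" using mem[of "- z"] by simp
      with v have "v \<bullet> (- z - x) \<le> 0" by blast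
      then show "(- v) \<bullet> (z - (- x)) \<le> 0" by (simp add: inner_diff_right inner_add_right)
    qed
  qed (use neg in simp)
  then show ?thesis
    by (metis ereal_uminus_eq_iff uminus_ereal.simps(1) vec_lambda_beta vector_uminus_component)
qed

text \<open>The sign pattern of \<open>v\<close> is a pair of coordinate sets, so there are finitely
  many pieces. Each has a local bound with its own radius and constant, and the minima over all
  pieces serve for every element of \<open>T w\<close>.\<close>

lemma box_inclusion_local_error_bound:
  fixes L :: "(real^'n) \<times> (real^'m) \<Rightarrow> real^'n" and R :: "(real^'n) \<times> (real^'m) \<Rightarrow> real^'m"
    and l u :: "ereal^'n"
  assumes L: "linear L" and R: "linear R"
    and T: "T = (\<lambda>w. {(L w + q + v, R w - b) | v. v \<in> subdifferential (indicator_fun (ext_box l u)) (fst w)})"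
    and w0: "w\<^sub>0 \<in> zeros T"
  shows "\<exists>\<epsilon>>0. \<exists>\<alpha>>0. error_bound_on T (ball w\<^sub>0 \<epsilon>) \<alpha>"
proof -
  define N where "N = subdifferential (indicator_fun (ext_box l u))"
  define lb where "lb = (\<lambda>i. real_of_ereal (l $ i))"
  define ub where "ub = (\<lambda>i. real_of_ereal (u $ i))"
  define IL where "IL = {i. \<bar>l $ i\<bar> \<noteq> \<infinity>}"
  define IU where "IU = {i. \<bar>u $ i\<bar> \<noteq> \<infinity>}"
  \<comment> \<open>A point of the box excludes a lower bound \<infinity> and an upper bound
    -\<infinity>. Every other infinite bound is no restriction, so the box is given by real
    inequalities indexed by \<open>IL\<close> and \<open>IU\<close>.\<close>
  obtain x0 where x0: "x0 \<in> ext_box l u"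
    using w0 by (auto simp: zeros_def T subdifferential_indicator_fun)
  have l_le: "l $ i \<le> ereal t \<longleftrightarrow> (i \<in> IL \<longrightarrow> lb i \<le> t)" for i t
    using x0 by (cases "l $ i") (auto simp: IL_def lb_def ext_box_def dest: spec[of _ i])
  have u_ge: "ereal t \<le> u $ i \<longleftrightarrow> (i \<in> IU \<longrightarrow> t \<le> ub i)" for i t
    using x0 by (cases "u $ i") (auto simp: IU_def ub_def ext_box_def dest: spec[of _ i])
  have box: "x \<in> ext_box l u \<longleftrightarrow> (\<forall>i\<in>IL. lb i \<le> x $ i) \<and> (\<forall>i\<in>IU. x $ i \<le> ub i)" for x
    by (auto simp: ext_box_def l_le u_ge)
  have piece: "\<exists>\<epsilon>>0. \<exists>\<alpha>>0. \<forall>w\<in>ball w\<^sub>0 \<epsilon>. \<forall>v\<in>N (fst w). {i. v $ i < 0} = J \<longrightarrow> {i. v $ i > 0} = K \<longrightarrow>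
      \<alpha> * infdist w (zeros T) \<le> norm (L w + q + v, R w - b)" for J K
  proof (cases "J \<subseteq> IL \<and> K \<subseteq> IU")
    case JK: True
    \<comment> \<open>At a zero the normal vector is \<open>- (L w + q)\<close>. The functions
      encode, in this order: \<open>fst w\<close> is in the box; it is at the lower bound on
      \<open>J\<close> and at the upper bound on \<open>K\<close>; the normal vector is nonnegative
      off \<open>J\<close> and nonpositive off \<open>K\<close>; and \<open>R w = b\<close>, as two
      inequalities per coordinate.\<close>
    define F where "F = (\<lambda>i w. lb i - fst w $ i) ` IL \<union> (\<lambda>i w. fst w $ i - ub i) ` IU
      \<union> (\<lambda>i w. fst w $ i - lb i) ` J \<union> (\<lambda>i w. ub i - fst w $ i) ` K
      \<union> (\<lambda>i w. (L w + q) $ i) ` (- J) \<union> (\<lambda>i w. - (L w + q) $ i) ` (- K)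
      \<union> range (\<lambda>j w. (R w - b) $ j) \<union> range (\<lambda>j w. - (R w - b) $ j)"
    have "\<exists>\<epsilon>>0. \<exists>\<alpha>>0. \<forall>w\<in>ball w\<^sub>0 \<epsilon>. \<forall>r\<ge>0. (\<forall>\<phi>\<in>F. \<phi> w \<le> r) \<longrightarrow> \<alpha> * infdist w (zeros T) \<le> r"
    proof (rule local_polyhedral_error_bound)
      show "finite F" by (simp add: F_def)
      show "linear (\<lambda>w. \<phi> w - \<phi> 0)" if "\<phi> \<in> F" for \<phi>
        using that L R by (auto simp: F_def linear_iff linear_0 algebra_simps)
      show "{w. \<forall>\<phi>\<in>F. \<phi> w \<le> 0} \<subseteq> zeros T"
      proof
        fix w assume "w \<in> {w. \<forall>\<phi>\<in>F. \<phi> w \<le> 0}"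
        then have w: "\<And>i. i \<in> IL \<Longrightarrow> lb i \<le> fst w $ i" "\<And>i. i \<in> IU \<Longrightarrow> fst w $ i \<le> ub i"
          "\<And>i. i \<in> J \<Longrightarrow> fst w $ i \<le> lb i" "\<And>i. i \<in> K \<Longrightarrow> ub i \<le> fst w $ i"
          "\<And>i. i \<notin> J \<Longrightarrow> (L w + q) $ i \<le> 0" "\<And>i. i \<notin> K \<Longrightarrow> 0 \<le> (L w + q) $ i"
          "\<And>j. (R w - b) $ j \<le> 0" "\<And>j. 0 \<le> (R w - b) $ j"
          by (auto simp: F_def ball_Un) (smt (verit) ComplI)
        have "- (L w + q) \<in> N (fst w)"
          unfolding N_def subdifferential_indicator_fun
        proof (intro conjI ballI)
          show "fst w \<in> ext_box l u" using w by (simp add: box)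
          fix z assume z: "z \<in> ext_box l u"
          \<comment> \<open>The normal cone inequality holds coordinatewise: on \<open>J\<close> or
            \<open>K\<close> the bound reached there fixes the sign of \<open>z - fst w\<close>, and
            off both sets the normal vector vanishes. \<open>J\<close> and \<open>K\<close> may
            overlap here, and then \<open>z - fst w\<close> vanishes in that coordinate.\<close>
          have "- (L w + q) $ i * (z - fst w) $ i \<le> 0" for i
          proof -
            have "i \<notin> J \<Longrightarrow> i \<notin> K \<Longrightarrow> (L w + q) $ i = 0"
              using w(5,6) by (simp add: order_antisym)
            moreover have "i \<in> J \<Longrightarrow> (z - fst w) $ i \<ge> 0" "i \<in> K \<Longrightarrow> (z - fst w) $ i \<le> 0"
              using w(3,4)[of i] z JK by (auto simp: box) force+
            ultimately show ?thesis
              using w(5,6)[of i] by (cases "i \<in> J"; cases "i \<in> K") (auto simp: mult_le_0_iff)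
          qed
          then show "- (L w + q) \<bullet> (z - fst w) \<le> 0"
            by (simp add: inner_vec_def sum_nonneg sum_nonpos)
        qed
        moreover have "R w - b = 0" using w(7,8) by (simp add: vec_eq_iff order_antisym)
        ultimately show "w \<in> zeros T"
          by (auto simp: zeros_def T N_def zero_prod_def intro!: exI[of _ "- (L w + q)"])
      qed
    qed (rule w0)
    then obtain \<epsilon> \<alpha> where "\<epsilon> > 0" "\<alpha> > 0" and
      \<alpha>: "\<And>w r. w \<in> ball w\<^sub>0 \<epsilon> \<Longrightarrow> r \<ge> 0 \<Longrightarrow> (\<forall>\<phi>\<in>F. \<phi> w \<le> r) \<Longrightarrow> \<alpha> * infdist w (zeros T) \<le> r"
      by blast
    \<comment> \<open>The conditions on \<open>fst w\<close> hold exactly, because a nonzero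
      \<open>v $ i\<close> puts coordinate \<open>i\<close> at its bound. Only the sign conditions
      and \<open>R w = b\<close> cost the residual: dropping \<open>v $ i\<close> from
      \<open>(L w + q + v) $ i\<close> is harmless in the direction given by its sign.\<close>
    moreover have "\<forall>\<phi>\<in>F. \<phi> w \<le> norm (L w + q + v, R w - b)"
      if v: "v \<in> N (fst w)" and J: "{i. v $ i < 0} = J" and K: "{i. v $ i > 0} = K" for w v
    proof -
      let ?r = "norm (L w + q + v, R w - b)"
      have x: "fst w \<in> ext_box l u" and nc: "\<forall>z\<in>ext_box l u. v \<bullet> (z - fst w) \<le> 0"
        using v by (auto simp: N_def subdifferential_indicator_fun)
      have r: "?r \<ge> 0" by simp
      have r1: "\<bar>(L w + q + v) $ i\<bar> \<le> ?r" for i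
        by (rule order_trans[OF component_le_norm_cart norm_fst_le])
      have r2: "\<bar>(R w - b) $ j\<bar> \<le> ?r" for j
        by (rule order_trans[OF component_le_norm_cart norm_snd_le])
      have up: "fst w $ i = ub i" if "i \<in> K" for i
        using ext_box_normal_upper[OF x nc, of i] that K unfolding ub_def
        by (metis real_of_ereal.simps(1) mem_Collect_eq)
      have lo: "fst w $ i = lb i" if "i \<in> J" for i
        using ext_box_normal_lower[OF x nc, of i] that J unfolding lb_def
        by (metis real_of_ereal.simps(1) mem_Collect_eq)
      have "\<forall>i\<in>IL. lb i \<le> fst w $ i" "\<forall>i\<in>IU. fst w $ i \<le> ub i" using x by (simp_all add: box)
      then have c1: "\<And>i. i \<in> IL \<Longrightarrow> lb i - fst w $ i \<le> ?r"
        and c2: "\<And>i. i \<in> IU \<Longrightarrow> fst w $ i - ub i \<le> ?r"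
        using r by (meson diff_le_0_iff_le order_trans)+
      have c3: "fst w $ i - lb i \<le> ?r" if "i \<in> J" for i using lo[OF that] r by simp
      have c4: "ub i - fst w $ i \<le> ?r" if "i \<in> K" for i using up[OF that] r by simp
      have c5: "(L w + q) $ i \<le> ?r" if "i \<notin> J" for i
        using r1[of i] that J by (auto simp: not_less)
      have c6: "- (L w + q) $ i \<le> ?r" if "i \<notin> K" for i
        using r1[of i] that K by (auto simp: not_less)
      have c7: "(R w - b) $ j \<le> ?r" "- (R w - b) $ j \<le> ?r" for j
        using r2[of j] by linarith+
      show ?thesis
        unfolding F_def ball_Un ball_simps
        by (intro conjI ballI c1 c2 c3 c4 c5 c6 c7) (use c7 in simp_all)
    qed
    ultimately show ?thesis
      by (intro exI[of _ \<epsilon>] conjI exI[of _ \<alpha>] ballI impI \<alpha>) simp_all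
  next
    case False
    \<comment> \<open>Nonzero entries of a normal vector need finite bounds, so this sign pattern
      never occurs and the claim is vacuous.\<close>
    have "J \<subseteq> IL \<and> K \<subseteq> IU" if v: "v \<in> N x" "{i. v $ i < 0} = J" "{i. v $ i > 0} = K" for x v
    proof -
      have x: "x \<in> ext_box l u" "\<forall>z\<in>ext_box l u. v \<bullet> (z - x) \<le> 0"
        using v(1) by (auto simp: N_def subdifferential_indicator_fun)
      have "i \<in> IL" if "v $ i < 0" for i
        using ext_box_normal_lower[OF x that, symmetric] by (simp add: IL_def)
      moreover have "i \<in> IU" if "v $ i > 0" for i
        using ext_box_normal_upper[OF x that, symmetric] by (simp add: IU_def)
      ultimately show ?thesis using v(2,3) by blast
    qed
    with False show ?thesis by (intro exI[of _ 1] conjI ballI impI zero_less_one) blast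
  qed
  moreover define Q where "Q = (\<lambda>\<epsilon> \<alpha> J K. \<forall>w\<in>ball w\<^sub>0 \<epsilon>. \<forall>v\<in>N (fst w).
      {i. v $ i < 0} = J \<longrightarrow> {i. v $ i > 0} = K \<longrightarrow>
      \<alpha> * infdist w (zeros T) \<le> norm (L w + q + v, R w - b))"
  ultimately have "\<forall>JK. \<exists>\<epsilon>>0. \<exists>\<alpha>>0. Q \<epsilon> \<alpha> (fst JK) (snd JK)" by simp
  then obtain \<epsilon> \<alpha> where \<epsilon>: "\<And>JK. \<epsilon> JK > 0" and \<alpha>: "\<And>JK. \<alpha> JK > 0"
    and Q: "\<And>JK. Q (\<epsilon> JK) (\<alpha> JK) (fst JK) (snd JK)" by metis
  have eb: "\<alpha> ({i. v $ i < 0}, {i. v $ i > 0}) * infdist w (zeros T) \<le> norm (L w + q + v, R w - b)"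
    if "w \<in> ball w\<^sub>0 (\<epsilon> ({i. v $ i < 0}, {i. v $ i > 0}))" "v \<in> N (fst w)" for w v
    using Q[of "({i. v $ i < 0}, {i. v $ i > 0})"] that by (simp add: Q_def)
  \<comment> \<open>The index type of the coordinates is finite, so there are finitely many pairs of
    sets and both minima are positive.\<close>
  define e where "e = Min (range \<epsilon>)"
  define a where "a = Min (range \<alpha>)"
  have e: "e > 0" "e \<le> \<epsilon> JK" and a: "a > 0" "a \<le> \<alpha> JK" for JK
    using \<epsilon> \<alpha> by (auto simp: e_def a_def)
  have "ereal (a * infdist w (zeros T)) \<le> ext_dist 0 (T w)" if "w \<in> ball w\<^sub>0 e" for w
    unfolding ext_dist_def
  proof (rule INF_greatest)
    fix s assume "s \<in> T w"
    then obtain v where s: "s = (L w + q + v, R w - b)" and v: "v \<in> N (fst w)"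
      by (auto simp: T N_def)
    let ?JK = "({i. v $ i < 0}, {i. v $ i > 0})"
    have "a * infdist w (zeros T) \<le> \<alpha> ?JK * infdist w (zeros T)"
      by (intro mult_right_mono a infdist_nonneg)
    also have "\<dots> \<le> norm s"
      unfolding s using that e(2)[of ?JK] by (intro eb v) auto
    finally show "ereal (a * infdist w (zeros T)) \<le> ereal (dist 0 s)" by simp
  qed
  then show ?thesis using e(1) a(1) unfolding error_bound_on_def by blast
qed

section \<open>Strongly monotone variational inequalities and gradients\<close>

text \<open>The solutions are the fixed points of the projected step \<open>G\<close>, which is a
  contraction for a suitable step length, so Banach's theorem applies.\<close>

lemma strongly_monotone_vi_exists:
  fixes \<Phi> :: "'a::euclidean_space \<Rightarrow> 'a"
  assumes C: "closed C" "convex C" "C \<noteq> {}" and \<mu>: "\<mu> > 0"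
    and mono: "\<And>x x'. \<mu> * (norm (x - x'))\<^sup>2 \<le> (\<Phi> x - \<Phi> x') \<bullet> (x - x')"
    and lip: "\<And>x x'. norm (\<Phi> x - \<Phi> x') \<le> K * norm (x - x')"
  shows "\<exists>x\<in>C. \<forall>z\<in>C. \<Phi> x \<bullet> (z - x) \<ge> 0"
proof -
  \<comment> \<open>The maximum gives at once \<open>L > 0\<close> and
    \<open>\<mu> / L \<le> 1\<close>, so that the root in \<open>c\<close> is taken of a nonnegative
    number.\<close>
  define L where "L = max K \<mu>"
  have L: "L > 0" "\<mu> \<le> L" using \<mu> by (auto simp: L_def)
  have lipL: "norm (\<Phi> x - \<Phi> x') \<le> L * norm (x - x')" for x x'
    using lip[of x x'] mult_right_mono[of K L "norm (x - x')"] by (simp add: L_def)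
  \<comment> \<open>This step length minimises
    \<open>1 - 2 * \<tau> * \<mu> + \<tau>\<^sup>2 * L\<^sup>2\<close>, the bound for the squared
    contraction factor; the minimum is \<open>c\<^sup>2\<close>.\<close>
  define \<tau> where "\<tau> = \<mu> / L\<^sup>2"
  have \<tau>: "\<tau> > 0" using \<mu> L by (simp add: \<tau>_def)
  define G where "G = (\<lambda>x. closest_point C (x - \<tau> *\<^sub>R \<Phi> x))"
  define c where "c = sqrt (1 - (\<mu> / L)\<^sup>2)"
  have ratio: "0 < \<mu> / L" "\<mu> / L \<le> 1" using \<mu> L by auto
  then have c0: "0 \<le> 1 - (\<mu> / L)\<^sup>2" by (simp add: power_le_one)
  then have c: "0 \<le> c" "c < 1" using \<mu> L by (auto simp: c_def)
  have norm_sq: "(norm (e - \<tau> *\<^sub>R d))\<^sup>2 = (norm e)\<^sup>2 - 2 * \<tau> * (d \<bullet> e) + \<tau>\<^sup>2 * (norm d)\<^sup>2"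
    for e d :: 'a
    unfolding power2_norm_eq_inner
    by (simp add: inner_diff_left inner_diff_right inner_commute[of e d] power2_eq_square right_diff_distrib)
  have "dist (G x) (G x') \<le> c * dist x x'" for x x'
  proof -
    let ?e = "x - x'" and ?d = "\<Phi> x - \<Phi> x'"
    have "(norm (?e - \<tau> *\<^sub>R ?d))\<^sup>2 = (norm ?e)\<^sup>2 - 2 * \<tau> * (?d \<bullet> ?e) + \<tau>\<^sup>2 * (norm ?d)\<^sup>2"
      by (rule norm_sq)
    also have "\<dots> \<le> (norm ?e)\<^sup>2 - 2 * \<tau> * (\<mu> * (norm ?e)\<^sup>2) + \<tau>\<^sup>2 * (L * norm ?e)\<^sup>2"
      using \<tau> mono[of x x'] lipL[of x x']
      by (intro add_mono diff_mono mult_left_mono power_mono) auto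
    also have "\<dots> = (1 - (\<mu> / L)\<^sup>2) * (norm ?e)\<^sup>2"
      using L by (simp add: \<tau>_def field_simps power2_eq_square)
    also have "\<dots> = (c * norm ?e)\<^sup>2" using c0 by (simp add: c_def power_mult_distrib)
    finally have "norm (?e - \<tau> *\<^sub>R ?d) \<le> c * norm ?e"
      using c by (auto intro: power2_le_imp_le)
    moreover have "dist (G x) (G x') \<le> norm (?e - \<tau> *\<^sub>R ?d)"
      using closest_point_lipschitz[OF C(2,1,3), of "x - \<tau> *\<^sub>R \<Phi> x" "x' - \<tau> *\<^sub>R \<Phi> x'"]
      by (simp add: G_def dist_norm algebra_simps)
    ultimately show ?thesis by (simp add: dist_norm)
  qed
  then obtain x where x: "G x = x" using banach_fix_type[OF c, of G] by blast
  have xC: "x \<in> C" using closest_point_in_set[OF C(1,3)] x unfolding G_def by metis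
  have "\<Phi> x \<bullet> (z - x) \<ge> 0" if "z \<in> C" for z
    using closest_point_dot[OF C(2,1) that, of "x - \<tau> *\<^sub>R \<Phi> x"] x \<tau>
    by (simp add: G_def zero_le_mult_iff)
  then show ?thesis using xC by blast
qed

text \<open>Restriction to the line through \<open>x\<close> and \<open>z\<close> reduces this to
  the tangent inequality in one real variable.\<close>

lemma convex_GDERIV_above_tangent:
  fixes f :: "'a::real_inner \<Rightarrow> real"
  assumes cv: "convex_on UNIV f" and der: "GDERIV f x :> D"
  shows "f x + D \<bullet> (z - x) \<le> f z"
proof -
  define \<phi> where "\<phi> = (\<lambda>t. f (x + t *\<^sub>R (z - x)))"
  have "convex_on UNIV \<phi>"
  proof (rule convex_onI)
    fix t s s' :: real assume t: "0 < t" "t < 1"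
    have "x + ((1 - t) *\<^sub>R s + t *\<^sub>R s') *\<^sub>R (z - x)
        = (1 - t) *\<^sub>R (x + s *\<^sub>R (z - x)) + t *\<^sub>R (x + s' *\<^sub>R (z - x))"
      by (simp add: algebra_simps)
    then show "\<phi> ((1 - t) *\<^sub>R s + t *\<^sub>R s') \<le> (1 - t) * \<phi> s + t * \<phi> s'"
      unfolding \<phi>_def using convex_onD[OF cv, of t] t by simp
  qed simp
  moreover have "(\<phi> has_real_derivative D \<bullet> (z - x)) (at 0)"
  proof -
    have "((\<lambda>t. x + t *\<^sub>R (z - x)) has_derivative (\<lambda>t. t *\<^sub>R (z - x))) (at 0)"
      by (auto intro!: derivative_eq_intros)
    moreover have "(f has_derivative (\<lambda>k. k \<bullet> D)) (at (x + 0 *\<^sub>R (z - x)))"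
      using der by (simp add: gderiv_def)
    ultimately have "(\<phi> has_derivative (\<lambda>t. (t *\<^sub>R (z - x)) \<bullet> D)) (at 0)"
      unfolding \<phi>_def by (rule has_derivative_compose)
    then show ?thesis
      by (simp add: has_field_derivative_def inner_commute mult_commute_abs)
  qed
  ultimately have "\<phi> 1 - \<phi> 0 \<ge> D \<bullet> (z - x) * (1 - 0)"
    by (intro convex_on_imp_above_tangent[where A = UNIV]) auto
  then show ?thesis by (simp add: \<phi>_def)
qed

text \<open>The tangent inequalities at the two points add up to this.\<close>

lemma convex_GDERIV_monotone:
  fixes f :: "'a::real_inner \<Rightarrow> real"
  assumes cv: "convex_on UNIV f" and der: "GDERIV f x :> D" "GDERIV f x' :> D'"
  shows "(D - D') \<bullet> (x - x') \<ge> 0"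
  using convex_GDERIV_above_tangent[OF cv der(1), of x'] convex_GDERIV_above_tangent[OF cv der(2), of x]
  by (simp add: inner_diff)

text \<open>The definite description in \<open>gradient\<close> needs an existing gradient; it is
  the vector representing the derivative.\<close>

lemma GDERIV_gradient:
  fixes f :: "'a::euclidean_space \<Rightarrow> real"
  assumes "f differentiable (at x)"
  shows "GDERIV f x :> gradient f x"
proof -
  obtain f' where f': "(f has_derivative f') (at x)" using assms by (auto simp: differentiable_def)
  then have "linear f'" by (rule has_derivative_linear)
  then have "f' = (\<lambda>k. k \<bullet> adjoint f' 1)" by (simp add: adjoint_works)
  with f' have "GDERIV f x :> adjoint f' 1" unfolding gderiv_def by metis
  then show ?thesis by (simp add: gradient_eqI)
qed

section \<open>Sharpness from an error bound\<close>

text \<open>The quadratic form has a positive minimum on the compact unit sphere and is homogeneous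
  of degree two.\<close>

lemma pos_def_op_lower_bound:
  fixes M :: "'a::euclidean_space \<Rightarrow> 'a"
  assumes "linear M" and pos: "\<And>w. w \<noteq> 0 \<Longrightarrow> 0 < w \<bullet> M w"
  shows "\<exists>\<mu>>0. \<forall>w. \<mu> * (norm w)\<^sup>2 \<le> w \<bullet> M w"
proof -
  have cont: "continuous_on (sphere 0 1) (\<lambda>w. w \<bullet> M w)"
    using assms(1) by (intro continuous_intros linear_continuous_on linear_conv_bounded_linear[THEN iffD1])
  have "\<exists>e::'a. norm e = 1" using vector_choose_size[of 1] by auto
  then have "sphere (0::'a) 1 \<noteq> {}" by auto
  then obtain e where e: "e \<in> sphere 0 1" "\<forall>w\<in>sphere 0 1. e \<bullet> M e \<le> w \<bullet> M w"
    using continuous_attains_inf[OF compact_sphere _ cont] by blast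
  have "(e \<bullet> M e) * (norm w)\<^sup>2 \<le> w \<bullet> M w" for w
  proof (cases "w = 0")
    case False
    let ?u = "(1 / norm w) *\<^sub>R w"
    have "?u \<in> sphere 0 1" using False by simp
    with e(2) have "e \<bullet> M e \<le> ?u \<bullet> M ?u" by blast
    also have "\<dots> = (w \<bullet> M w) / (norm w)\<^sup>2"
      by (simp add: linear_scale[OF assms(1)] power2_eq_square)
    finally show ?thesis using False by (simp add: field_simps)
  qed simp
  moreover have "e \<bullet> M e > 0" using e(1) by (intro pos) auto
  ultimately show ?thesis by blast
qed

text \<open>Common frame for both maps: \<open>e w\<close> is a residual at the image point
  \<open>F w\<close>, where the error bound is applied. This bounds the distance from
  \<open>F w\<close> to the zeros by a multiple of the step; the triangle inequality carries it back
  to \<open>w\<close>, and equivalence of norms passes to the norm of \<open>M\<close>.\<close>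

lemma sharp_onI:
  fixes M :: "'a::euclidean_space \<Rightarrow> 'a"
  assumes M: "pos_def_op M" and ne: "zeros T \<noteq> {}" and \<alpha>: "\<alpha> > 0"
    and eb: "error_bound_on T U \<alpha>"
    and F: "\<And>w. w \<in> K \<Longrightarrow> F w \<in> U" and e: "\<And>w. w \<in> K \<Longrightarrow> e w \<in> T (F w)"
    and e_le: "\<And>w. w \<in> K \<Longrightarrow> norm (e w) \<le> c * norm (w - F w)"
  shows "sharp_on M (zeros T) F K"
proof -
  let ?W = "zeros T"
  have lM: "linear M" using M unfolding pos_def_op_def by blast
  obtain \<mu> where \<mu>: "\<mu> > 0" "\<And>w. \<mu> * (norm w)\<^sup>2 \<le> w \<bullet> M w"
    using pos_def_op_lower_bound[OF lM] M unfolding pos_def_op_def by blast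
  obtain B where B: "B > 0" "\<And>w. norm (M w) \<le> B * norm w"
    using linear_bounded_pos[OF lM] by blast
  have lower: "sqrt \<mu> * norm w \<le> norm_op M w" for w
    using real_sqrt_le_mono[OF \<mu>(2)[of w]] by (simp add: norm_op_def real_sqrt_mult)
  have upper: "norm_op M w \<le> sqrt B * norm w" for w
  proof -
    have "w \<bullet> M w \<le> norm w * (B * norm w)"
      by (rule order_trans[OF norm_cauchy_schwarz mult_left_mono[OF B(2)]]) simp
    then have "w \<bullet> M w \<le> B * (norm w)\<^sup>2" by (simp add: power2_eq_square mult_ac)
    from real_sqrt_le_mono[OF this] show ?thesis by (simp add: norm_op_def real_sqrt_mult)
  qed
  \<comment> \<open>The infimum in \<open>dist_op\<close> is real, so it lies below its members only
    once a lower bound is known.\<close>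
  have bdd: "bdd_below ((\<lambda>u. norm_op M (w - u)) ` ?W)" for w
    using lower order_trans[OF _ lower] \<mu>(1) by (intro bdd_belowI[of _ 0]) fastforce
  have dist_le: "dist_op M w ?W \<le> sqrt B * infdist w ?W" for w
  proof -
    have "dist_op M w ?W / sqrt B \<le> infdist w ?W"
      unfolding infdist_notempty[OF ne]
    proof (rule cINF_greatest[OF ne])
      fix u assume "u \<in> ?W"
      then have "dist_op M w ?W \<le> norm_op M (w - u)"
        unfolding dist_op_def by (intro cINF_lower bdd)
      also have "\<dots> \<le> sqrt B * dist w u" using upper by (simp add: dist_norm)
      finally show "dist_op M w ?W / sqrt B \<le> dist w u" using B(1) by (simp add: field_simps)
    qed
    then show ?thesis using B(1) by (simp add: field_simps)
  qed
  \<comment> \<open>The factor \<open>1 + \<bar>c\<bar> / \<alpha>\<close> comes from the triangle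
    inequality and the two roots from the change of norm. The absolute value allows any sign of
    \<open>c\<close>.\<close>
  define \<kappa> where "\<kappa> = sqrt B * (1 + \<bar>c\<bar> / \<alpha>) / sqrt \<mu>"
  have \<kappa>: "\<kappa> > 0" using B(1) \<alpha> \<mu>(1) by (auto simp: \<kappa>_def intro!: mult_pos_pos divide_pos_pos add_pos_nonneg)
  have "1 / \<kappa> * dist_op M w ?W \<le> norm_op M (w - F w)" if w: "w \<in> K" for w
  proof -
    have "ereal (\<alpha> * infdist (F w) ?W) \<le> ext_dist 0 (T (F w))"
      using eb F[OF w] by (auto simp: error_bound_on_def)
    also have "\<dots> \<le> ereal (norm (e w))"
      unfolding ext_dist_def using e[OF w] by (intro INF_lower2[of "e w"]) auto
    finally have "\<alpha> * infdist (F w) ?W \<le> \<bar>c\<bar> * norm (w - F w)"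
      using e_le[OF w] mult_right_mono[OF abs_ge_self[of c], of "norm (w - F w)"] by simp
    then have "infdist (F w) ?W \<le> \<bar>c\<bar> / \<alpha> * norm (w - F w)"
      using \<alpha> by (simp add: field_simps)
    then have "infdist w ?W \<le> (1 + \<bar>c\<bar> / \<alpha>) * norm (w - F w)"
      using infdist_triangle[of w ?W "F w"] by (simp add: dist_norm algebra_simps)
    then have "dist_op M w ?W \<le> sqrt B * ((1 + \<bar>c\<bar> / \<alpha>) * norm (w - F w))"
      using B(1) by (intro order_trans[OF dist_le mult_left_mono]) auto
    also have "\<dots> = \<kappa> * (sqrt \<mu> * norm (w - F w))" using \<mu>(1) by (simp add: \<kappa>_def)
    also have "\<dots> \<le> \<kappa> * norm_op M (w - F w)" using \<kappa> lower by (intro mult_left_mono) auto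
    finally show ?thesis using \<kappa> by (simp add: field_simps)
  qed
  then show ?thesis using \<kappa> unfolding sharp_on_def by (intro exI[of _ "1 / \<kappa>"]) auto
qed

section \<open>The block operator and the iteration maps\<close>

lemma inner_matrix_transpose:
  fixes A :: "real^'n^'m"
  shows "x \<bullet> (transpose A *v y) = (A *v x) \<bullet> y"
  by (metis dot_lmul_matrix inner_commute transpose_matrix_vector transpose_transpose)

text \<open>Symmetry makes the two terms of the product rule equal, which absorbs the factor
  1/2.\<close>

lemma GDERIV_quadratic:
  fixes G :: "real^'n^'n"
  assumes "transpose G = G"
  shows "GDERIV (\<lambda>x. 1 / 2 * (x \<bullet> (G *v x)) + c \<bullet> x) x :> G *v x + c"
proof -
  have sym: "x \<bullet> (G *v k) = k \<bullet> (G *v x)" for k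
    by (metis assms inner_commute inner_matrix_transpose)
  have "((\<lambda>x. 1 / 2 * (x \<bullet> (G *v x)) + c \<bullet> x) has_derivative
      (\<lambda>k. 1 / 2 * (x \<bullet> (G *v k) + k \<bullet> (G *v x)) + c \<bullet> k)) (at x)"
    by (intro has_derivative_add has_derivative_mult_right has_derivative_inner_right
        has_derivative_inner has_derivative_ident
        bounded_linear_imp_has_derivative[OF matrix_vector_mul_bounded_linear])
  then show ?thesis
    unfolding gderiv_def by (simp add: sym inner_add_right inner_commute[of c])
qed

lemma GDERIV_least_squares:
  fixes A :: "real^'n^'m"
  shows "GDERIV (\<lambda>x. \<sigma> / 2 * (norm (A *v x - b))\<^sup>2) x :> \<sigma> *\<^sub>R (transpose A *v (A *v x - b))"
proof -
  have "((\<lambda>x. \<sigma> / 2 * ((A *v x - b) \<bullet> (A *v x - b))) has_derivative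
      (\<lambda>k. \<sigma> / 2 * ((A *v x - b) \<bullet> (A *v k - 0) + (A *v k - 0) \<bullet> (A *v x - b)))) (at x)"
    by (intro has_derivative_mult_right has_derivative_inner has_derivative_diff has_derivative_const
        bounded_linear_imp_has_derivative[OF matrix_vector_mul_bounded_linear])
  moreover have "\<sigma> / 2 * ((A *v x - b) \<bullet> (A *v k - 0) + (A *v k - 0) \<bullet> (A *v x - b))
      = k \<bullet> (\<sigma> *\<^sub>R (transpose A *v (A *v x - b)))" for k
    unfolding inner_scaleR_right inner_matrix_transpose by (simp add: inner_commute)
  ultimately show ?thesis by (simp only: gderiv_def power2_norm_eq_inner)
qed

text \<open>A vector with one zero block sees only one diagonal block. The first part makes the
  inclusion for \<open>x\<close> strongly monotone, the second makes the system for \<open>y\<close>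
  solvable.\<close>

lemma pos_def_block_opD:
  assumes "pos_def_op (block_op P A Q)"
  shows "x \<noteq> 0 \<Longrightarrow> 0 < x \<bullet> (P *v x)" and "y \<noteq> 0 \<Longrightarrow> 0 < y \<bullet> (Q *v y)"
proof -
  have pos: "w \<noteq> 0 \<Longrightarrow> 0 < w \<bullet> block_op P A Q w" for w
    using assms unfolding pos_def_op_def by blast
  show "x \<noteq> 0 \<Longrightarrow> 0 < x \<bullet> (P *v x)"
    using pos[of "(x, 0)"] by (simp add: block_op_def zero_prod_def)
  show "y \<noteq> 0 \<Longrightarrow> 0 < y \<bullet> (Q *v y)"
    using pos[of "(0, y)"] by (simp add: block_op_def zero_prod_def)
qed

text \<open>The off-diagonal block of \<open>M\<close> cancels the term \<open>- A\<^sup>T y\<close> of the operator, so the inclusion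
  is block triangular: a strongly monotone variational inequality for \<open>x\<close>, then a linear system for
  \<open>y\<close>.\<close>

lemma inv_sum_block_singleton:
  fixes A :: "real^'n^'m" and \<Psi> :: "real^'n \<Rightarrow> real^'n"
  assumes M: "pos_def_op (block_op P A Q)"
    and C: "closed C" "convex C" "C \<noteq> {}"
    and mono: "\<And>x x'. 0 \<le> (\<Psi> x - \<Psi> x') \<bullet> (x - x')"
    and lip: "\<And>x x'. norm (\<Psi> x - \<Psi> x') \<le> K * norm (x - x')"
    and S: "\<And>x y. S (x, y) = {(\<Psi> x - transpose A *v y + v, A *v x - b) | v.
              v \<in> subdifferential (indicator_fun C) x}"
  shows "\<exists>z. inv_sum (block_op P A Q) S r = {z}"
proof -
  obtain r1 r2 where r: "r = (r1, r2)" by (cases r)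
  \<comment> \<open>The first row of the inclusion, after the terms in \<open>y\<close> cancel,
    reads \<open>- \<Phi> x = v\<close> with \<open>v\<close> in the normal cone.\<close>
  define \<Phi> where "\<Phi> = (\<lambda>x. P *v x + \<Psi> x - r1)"
  obtain \<mu> where \<mu>: "\<mu> > 0" "\<And>x. \<mu> * (norm x)\<^sup>2 \<le> x \<bullet> (P *v x)"
    using pos_def_op_lower_bound[OF matrix_vector_mul_linear[of P] pos_def_block_opD(1)[OF M]] by blast
  obtain KP where KP: "\<And>x. norm (P *v x) \<le> KP * norm x"
    using linear_bounded_pos[OF matrix_vector_mul_linear[of P]] by blast
  have \<Phi>_diff: "\<Phi> x - \<Phi> x' = P *v (x - x') + (\<Psi> x - \<Psi> x')" for x x'
    by (simp add: \<Phi>_def matrix_vector_mult_diff_distrib)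
  have mono\<Phi>: "\<mu> * (norm (x - x'))\<^sup>2 \<le> (\<Phi> x - \<Phi> x') \<bullet> (x - x')" for x x'
    using \<mu>(2)[of "x - x'"] mono[of x x'] unfolding \<Phi>_diff inner_add_left
    by (simp add: inner_commute)
  have lip\<Phi>: "norm (\<Phi> x - \<Phi> x') \<le> (KP + K) * norm (x - x')" for x x'
    using norm_triangle_mono[OF KP[of "x - x'"] lip[of x x']] unfolding \<Phi>_diff
    by (simp add: distrib_right)
  have kerQ: "y = 0" if "Q *v y = 0" for y
    using pos_def_block_opD(2)[OF M, of y] that by (cases "y = 0") auto
  then have injQ: "inj ((*v) Q)"
    using linear_injective_0[OF matrix_vector_mul_linear[of Q]] by blast
  then have surjQ: "surj ((*v) Q)"
    by (rule linear_inj_imp_surj[OF matrix_vector_mul_linear])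
  have bex_image: "(\<exists>s\<in>{g v | v. v \<in> N}. R s) \<longleftrightarrow> (\<exists>v\<in>N. R (g v))"
    for g :: "real^'n \<Rightarrow> (real^'n) \<times> (real^'m)" and N R
    by blast
  \<comment> \<open>In the second row \<open>A *v x\<close> occurs twice, once from the block
    operator and once from \<open>S\<close>.\<close>
  have mem: "(x, y) \<in> inv_sum (block_op P A Q) S r \<longleftrightarrow>
      - \<Phi> x \<in> subdifferential (indicator_fun C) x \<and> Q *v y = r2 - (A *v x + A *v x - b)" for x y
  proof -
    have "(x, y) \<in> inv_sum (block_op P A Q) S r \<longleftrightarrow>
      (\<exists>v\<in>subdifferential (indicator_fun C) x. v = - \<Phi> x) \<and> Q *v y = r2 - (A *v x + A *v x - b)"
      unfolding inv_sum_def mem_Collect_eq S r block_op_def \<Phi>_def bex_image by (auto simp: algebra_simps)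
    then show ?thesis by auto
  qed
  have uniq: "x = x' \<and> y = y'"
    if "(x, y) \<in> inv_sum (block_op P A Q) S r" "(x', y') \<in> inv_sum (block_op P A Q) S r" for x y x' y'
  proof -
    have x: "x \<in> C" "x' \<in> C" "\<forall>z\<in>C. - \<Phi> x \<bullet> (z - x) \<le> 0" "\<forall>z\<in>C. - \<Phi> x' \<bullet> (z - x') \<le> 0"
      using that by (auto simp: mem subdifferential_indicator_fun)
    \<comment> \<open>Each variational inequality is tested with the other solution; the sum
      contradicts strong monotonicity unless \<open>x = x'\<close>.\<close>
    then have "- \<Phi> x \<bullet> (x' - x) \<le> 0" "- \<Phi> x' \<bullet> (x - x') \<le> 0" by auto
    then have "(\<Phi> x - \<Phi> x') \<bullet> (x - x') \<le> 0" by (simp add: inner_diff)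
    then have "\<mu> * (norm (x - x'))\<^sup>2 \<le> 0" using mono\<Phi>[of x x'] by linarith
    then have "x = x'" using \<mu>(1) by (simp add: mult_le_0_iff)
    moreover from this that have "Q *v y = Q *v y'" by (simp add: mem)
    ultimately show ?thesis using injD[OF injQ] by blast
  qed
  obtain x where x: "x \<in> C" "\<forall>z\<in>C. \<Phi> x \<bullet> (z - x) \<ge> 0"
    using strongly_monotone_vi_exists[OF C \<mu>(1) mono\<Phi> lip\<Phi>] by blast
  obtain y where "Q *v y = r2 - (A *v x + A *v x - b)" using surjQ by (metis surjD)
  then have "(x, y) \<in> inv_sum (block_op P A Q) S r"
    using x by (simp add: mem subdifferential_indicator_fun)
  then have "inv_sum (block_op P A Q) S r = {(x, y)}" using uniq by auto
  then show ?thesis by blast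
qed

text \<open>The second conjunct ranges over every neighborhood with an error bound, not only over
  the balls that the first one produces.\<close>

theorem proposition14:
  fixes A :: "real^'n^'m" and b :: "real^'m" and c :: "real^'n" and H :: "real^'n^'n"
    and P :: "real^'n^'n" and Q :: "real^'m^'m" and \<sigma> L\<^sub>h :: real
    and l u :: "ereal^'n" and f h :: "real^'n \<Rightarrow> real"
  defines "M \<equiv> block_op P A Q"
    and "T \<equiv> kkt_op A b \<sigma> f (indicator_fun (ext_box l u))"
    and "B \<equiv> lin_op h"
  assumes "\<sigma> \<ge> 0" and "transpose H = H" and "psd_matrix P" and "psd_matrix Q"
    and "ext_box l u \<noteq> {}"
    and "f = (\<lambda>x. inner c x) \<or>
         (f = (\<lambda>x. 1 / 2 * inner x (H *v x) + inner c x) \<and> psd_matrix H)"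
    and "zeros T \<noteq> {}"
    and "convex_on UNIV h" and "\<forall>x. h differentiable (at x)"
    and "continuous_on UNIV (gradient h)" and "L\<^sub>h-lipschitz_on UNIV (gradient h)"
    and "convex_on UNIV (\<lambda>x. f x - h x + \<sigma> / 2 * (norm (A *v x - b))\<^sup>2)"
  shows "(\<forall>w\<^sub>0\<in>zeros T. \<exists>U \<alpha>. w\<^sub>0 \<in> interior U \<and> \<alpha> > 0 \<and> error_bound_on T U \<alpha>) \<and>
    (\<forall>w\<^sub>0\<in>zeros T. \<forall>U \<alpha>. w\<^sub>0 \<in> interior U \<and> \<alpha> > 0 \<and> error_bound_on T U \<alpha> \<longrightarrow>
       pos_def_op M \<longrightarrow>
       (\<forall>K. exact_map M T ` K \<union> linearized_map M T B ` K \<subseteq> U \<longrightarrow>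
          sharp_on M (zeros T) (exact_map M T) K \<and>
          sharp_on M (zeros T) (linearized_map M T B) K))"
proof -
  let ?N = "\<lambda>x. subdifferential (indicator_fun (ext_box l u)) x"
  \<comment> \<open>\<open>G = 0\<close> covers the linear objective, so both cases are treated as
    one convex quadratic.\<close>
  obtain G :: "real^'n^'n" where G: "psd_matrix G" "f = (\<lambda>x. 1 / 2 * inner x (G *v x) + inner c x)"
  proof -
    have "psd_matrix (0 :: real^'n^'n)" by (simp add: psd_matrix_def transpose_def vec_eq_iff)
    then show ?thesis using assms(9) that[of 0] that[of H] by auto
  qed
  \<comment> \<open>\<open>D\<close> and \<open>q\<close> are the linear and constant parts of the
    gradient of \<open>f\<close> plus the penalty gradient.\<close>
  define D where "D = (\<lambda>x. G *v x + \<sigma> *\<^sub>R (transpose A *v (A *v x)))"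
  define q where "q = c - \<sigma> *\<^sub>R (transpose A *v b)"
  have linD: "linear D"
    unfolding D_def by (intro linear_compose_add linear_compose_scale_right
        linear_compose[OF matrix_vector_mul_linear matrix_vector_mul_linear, unfolded o_def] matrix_vector_mul_linear)
  have gf: "GDERIV f x :> G *v x + c" for x
    unfolding G(2) using G(1) by (intro GDERIV_quadratic) (simp add: psd_matrix_def)
  have Dq: "D x + q = G *v x + c + \<sigma> *\<^sub>R (transpose A *v (A *v x - b))" for x
    by (simp add: D_def q_def algebra_simps matrix_vector_mult_diff_distrib scaleR_diff_right del: transpose_matrix_vector)
  have T_eq: "T (x, y) = {(D x + q - transpose A *v y + v, A *v x - b) | v. v \<in> ?N x}" for x y
    unfolding T_def kkt_op_def gradient_eqI[OF gf] Dq by (simp add: algebra_simps del: transpose_matrix_vector)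
  have T_eq': "T = (\<lambda>w. {((D (fst w) - transpose A *v snd w) + q + v, A *v fst w - b) | v. v \<in> ?N (fst w)})"
    by (rule ext) (auto simp: T_eq algebra_simps simp del: transpose_matrix_vector split: prod.split)
  have local: "\<exists>U \<alpha>. w\<^sub>0 \<in> interior U \<and> \<alpha> > 0 \<and> error_bound_on T U \<alpha>" if w0: "w\<^sub>0 \<in> zeros T" for w\<^sub>0
  proof -
    have "linear (\<lambda>w. D (fst w) - transpose A *v snd w)" "linear (\<lambda>w. A *v fst w)"
      using linear_compose[OF linear_fst linD] linear_compose[OF linear_snd matrix_vector_mul_linear[of "transpose A"]]
        linear_compose[OF linear_fst matrix_vector_mul_linear[of A]]
      by (auto intro!: linear_compose_sub simp: o_def)
    from box_inclusion_local_error_bound[OF this T_eq' w0]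
    obtain \<epsilon> \<alpha> where "\<epsilon> > 0" "\<alpha> > 0" "error_bound_on T (ball w\<^sub>0 \<epsilon>) \<alpha>" by blast
    then show ?thesis by (intro exI[of _ "ball w\<^sub>0 \<epsilon>"] exI[of _ \<alpha>]) auto
  qed
  have sharp: "sharp_on M (zeros T) (exact_map M T) K" "sharp_on M (zeros T) (linearized_map M T B) K"
    if \<alpha>: "\<alpha> > 0" and eb: "error_bound_on T U \<alpha>" and M: "pos_def_op M"
      and K: "exact_map M T ` K \<union> linearized_map M T B ` K \<subseteq> U" for U \<alpha> K
  proof -
    obtain KD where KD: "\<And>x. norm (D x) \<le> KD * norm x" using linear_bounded_pos[OF linD] by blast
    have linM: "linear M" using M unfolding pos_def_op_def by blast
    obtain KM where KM: "\<And>w. norm (M w) \<le> KM * norm w" using linear_bounded_pos[OF linM] by metis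
    have lipD: "norm (D x + q - (D x' + q)) \<le> KD * norm (x - x')" for x x'
      using KD[of "x - x'"] by (simp add: linear_diff[OF linD])
    have monoD: "0 \<le> (D x + q - (D x' + q)) \<bullet> (x - x')" for x x'
    proof -
      have "(D x + q - (D x' + q)) \<bullet> (x - x') = (x - x') \<bullet> D (x - x')"
        by (simp add: linear_diff[OF linD] inner_commute)
      also have "\<dots> = (x - x') \<bullet> (G *v (x - x')) + \<sigma> * ((A *v (x - x')) \<bullet> (A *v (x - x')))"
        unfolding D_def inner_add_right inner_scaleR_right inner_matrix_transpose ..
      also have "\<dots> \<ge> 0" using G(1) \<open>\<sigma> \<ge> 0\<close> by (simp add: psd_matrix_def)
      finally show ?thesis .
    qed
    have gh: "GDERIV h x :> gradient h x" for x by (rule GDERIV_gradient) (use assms in blast)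
    have liph: "norm (gradient h x - gradient h x') \<le> L\<^sub>h * norm (x - x')" for x x'
      using lipschitz_onD[OF \<open>L\<^sub>h-lipschitz_on UNIV (gradient h)\<close>, of x x'] by (simp add: dist_norm)
    \<comment> \<open>The function assumed convex has as gradient the single-valued part of
      \<open>T - B\<close> in \<open>x\<close>, apart from the term in \<open>y\<close>; this yields
      monotonicity for the linearized inclusion.\<close>
    have \<psi>: "GDERIV (\<lambda>x. f x - h x + \<sigma> / 2 * (norm (A *v x - b))\<^sup>2) x :> D x + q - gradient h x" for x
      using GDERIV_add[OF GDERIV_diff[OF gf gh] GDERIV_least_squares[of \<sigma> A b x]]
      unfolding Dq by (rule GDERIV_subst) (simp add: algebra_simps del: transpose_matrix_vector)
    have monoh: "0 \<le> (D x + q - gradient h x - (D x' + q - gradient h x')) \<bullet> (x - x')" for x x'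
      by (rule convex_GDERIV_monotone[OF _ \<psi> \<psi>]) (use assms in blast)
    have lipDh: "norm (D x + q - gradient h x - (D x' + q - gradient h x')) \<le> (KD + L\<^sub>h) * norm (x - x')" for x x'
      using norm_triangle_ineq4[of "D x + q - (D x' + q)" "gradient h x - gradient h x'"] lipD[of x x'] liph[of x x']
      by (simp add: algebra_simps)
    note C = closed_ext_box[of l u] convex_ext_box[of l u] \<open>ext_box l u \<noteq> {}\<close>
    have "\<exists>z. inv_sum M T r = {z}" for r
      unfolding M_def by (rule inv_sum_block_singleton[OF M[unfolded M_def] C monoD lipD T_eq])
    \<comment> \<open>Since the value is a singleton, \<open>the_elem\<close> returns a genuine
      solution of the inclusion.\<close>
    then have exact: "exact_map M T w \<in> inv_sum M T (M w)" for w
      unfolding exact_map_def by (metis singletonI the_elem_eq)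
    have "(\<lambda>v. v - B (x, y)) ` T (x, y) =
        {(D x + q - gradient h x - transpose A *v y + v, A *v x - b) | v. v \<in> ?N x}" for x y
      unfolding T_eq B_def lin_op_def by (auto simp: image_iff algebra_simps simp del: transpose_matrix_vector)
    then have "\<exists>z. inv_sum M (\<lambda>z. (\<lambda>v. v - B z) ` T z) r = {z}" for r
      unfolding M_def by (rule inv_sum_block_singleton[OF M[unfolded M_def] C monoh lipDh])
    then have lin: "linearized_map M T B w \<in> inv_sum M (\<lambda>z. (\<lambda>v. v - B z) ` T z) (M w - B w)" for w
      unfolding linearized_map_def by (metis singletonI the_elem_eq)
    show "sharp_on M (zeros T) (exact_map M T) K"
    proof (rule sharp_onI[OF M \<open>zeros T \<noteq> {}\<close> \<alpha> eb])
      fix w assume "w \<in> K"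
      then show "exact_map M T w \<in> U" using K by blast
      show "M (w - exact_map M T w) \<in> T (exact_map M T w)"
        using exact[of w] by (auto simp: inv_sum_def linear_diff[OF linM])
    qed (rule KM)
    show "sharp_on M (zeros T) (linearized_map M T B) K"
    proof (rule sharp_onI[OF M \<open>zeros T \<noteq> {}\<close> \<alpha> eb])
      fix w assume "w \<in> K"
      let ?z = "linearized_map M T B w"
      show "?z \<in> U" using K \<open>w \<in> K\<close> by blast
      \<comment> \<open>The inclusion reads \<open>M w - B w = M ?z + (v - B ?z)\<close> with
        \<open>v\<close> in \<open>T ?z\<close>; solving for \<open>v\<close> gives the
        residual.\<close>
      show "M (w - ?z) - (B w - B ?z) \<in> T ?z"
        using lin[of w] by (auto simp: inv_sum_def linear_diff[OF linM] algebra_simps)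
      \<comment> \<open>Lipschitz continuity of the gradient of \<open>h\<close> bounds the
        correction by the step, so the residual constant is \<open>KM + L\<^sub>h\<close>.\<close>
      have "norm (B w - B ?z) = norm (gradient h (fst w) - gradient h (fst ?z))"
        by (simp add: B_def lin_op_def split_beta)
      also have "\<dots> \<le> L\<^sub>h * norm (fst (w - ?z))" using liph[of "fst w" "fst ?z"] by simp
      also have "\<dots> \<le> L\<^sub>h * norm (w - ?z)"
        by (intro mult_left_mono lipschitz_on_nonneg[OF \<open>L\<^sub>h-lipschitz_on UNIV (gradient h)\<close>])
          (metis norm_fst_le prod.collapse)
      finally show "norm (M (w - ?z) - (B w - B ?z)) \<le> (KM + L\<^sub>h) * norm (w - ?z)"
        using norm_triangle_ineq4[of "M (w - ?z)" "B w - B ?z"] KM[of "w - ?z"]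
        by (simp add: algebra_simps)
    qed
  qed
  show ?thesis
  proof (intro conjI ballI allI impI)
    fix w\<^sub>0 assume "w\<^sub>0 \<in> zeros T"
    then show "\<exists>U \<alpha>. w\<^sub>0 \<in> interior U \<and> \<alpha> > 0 \<and> error_bound_on T U \<alpha>" by (rule local)
  next
    fix w\<^sub>0 U \<alpha> K
    assume "w\<^sub>0 \<in> interior U \<and> \<alpha> > 0 \<and> error_bound_on T U \<alpha>" "pos_def_op M"
      "exact_map M T ` K \<union> linearized_map M T B ` K \<subseteq> U"
    then show "sharp_on M (zeros T) (exact_map M T) K" "sharp_on M (zeros T) (linearized_map M T B) K"
      using sharp[of \<alpha> U K] by blast+
  qed
qed

end
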